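(* There is a positive constant $C$, independent of $d$, such that for every positive integer $d$ and all sufficiently large $n$ (how large may depend on $d$), $$b(n,d)\leq C\, n^{-1/2^d}\cdot 2^n.$$
   Context: Let $[n]=\{1,2,\ldots,n\}$ and let $2^{[n]}$ denote the power set of $[n]$. A collection $\mathcal{B}\subseteq 2^{[n]}$ forms a $d$-dimensional Boolean algebra (a copy of $\mathcal{B}_d$) if there exist pairwise disjoint sets $X_0,X_1,\ldots,X_d\subseteq[n]$, all non-empty with perhaps the exception of $X_0$, such that $\mathcal{B}=\{X_0\cup\bigcup_{i\in I}X_i : I\subseteq[d]\}$. A family $\mathcal{F}\subseteq 2^{[n]}$ is $\mathcal{B}_d$-free if no subcollection of $\mathcal{F}$ is a $d$-dimensional Boolean algebra. Define $b(n,d)$ to be the maximum cardinality of a $\mathcal{B}_d$-free family $\mathcal{F}\subseteq 2^{[n]}$. *)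

theory Defs
  imports Complex_Main "HOL-Library.Disjoint_Sets"
begin

(* Only the values X 0, ..., X d are relevant; X 0 is allowed to be empty. *)
definition is_boolean_algebra :: "nat \<Rightarrow> nat \<Rightarrow> nat set set \<Rightarrow> bool" where
  "is_boolean_algebra n d B \<longleftrightarrow>
     (\<exists>X :: nat \<Rightarrow> nat set.
        (\<forall>i\<in>{0..d}. X i \<subseteq> {1..n}) \<and>
        disjoint_family_on X {0..d} \<and>
        (\<forall>i\<in>{1..d}. X i \<noteq> {}) \<and>
        B = {X 0 \<union> (\<Union>i\<in>I. X i) | I. I \<subseteq> {1..d}})"

definition boolean_algebra_free :: "nat \<Rightarrow> nat \<Rightarrow> nat set set \<Rightarrow> bool" where
  "boolean_algebra_free n d F \<longleftrightarrow> (\<forall>B. B \<subseteq> F \<longrightarrow> \<not> is_boolean_algebra n d B)"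

(* The set below is finite, and nonempty because the empty family is always free,
   so Max is a genuine maximum. *)
definition boolean_free_number :: "nat \<Rightarrow> nat \<Rightarrow> nat" where
  "boolean_free_number n d = Max {card F | F. F \<subseteq> Pow {1..n} \<and> boolean_algebra_free n d F}"

end

theory Submission
  imports Defs "HOL-Analysis.Convex" "HOL-Combinatorics.Multiset_Permutations"
begin

text \<open>
  Write $h(F) = \sum_{A \in F} 1 / {n \choose |A|}$ for the Lubell value of $F$; it is the expected
  number $X$ of members of $F$ on a uniformly random maximal chain of the power set. The key is a
  second-moment argument along this chain. Two members of $F$ on the chain are comparable, say
  $A \subset A \cup D$, and then $A$ lies in the slice $F_D$ of all $A \in F$ disjoint from $D$ with
  $A \cup D \in F$. For fixed $D$ the chain passes through $A$ and $A \cup D$ with probability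
  $1 / ({n \choose |D|} {n - |D| \choose |A|})$, so $E[X]^2 \le E[X^2]$ becomes
  $$h(F)^2 \le h(F) + 2 \sum_{D \neq \emptyset} h(F_D) / {n \choose |D|}$$
  (\<open>lubell_square_le\<close>).

  If $F$ has no $(d+1)$-dimensional Boolean algebra, then no slice has a $d$-dimensional one, because
  $D$ would serve as the additional direction. If moreover the sizes of the members of $F$ lie among
  $L$ consecutive numbers, only sets $D$ with $|D| < L$ have nonempty slices, and summing
  $1 / {n \choose |D|}$ over these contributes at most $1$ for each size. Hence a bound $c$ for
  dimension $d$ gives $h^2 \le h + 2 L c$ for dimension $d + 1$. The exponent of $L$ thus passes from
  $e$ to $(1 + e)/2$ and converges to $1$, while the constant passes from $c$ to about $\sqrt{2 c}$
  and so stays bounded: $h(F) \le 3 L^{1 - 2/2^d}$ for all $d$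
  (\<open>lubell_le_if_not_contains_cube\<close>). This is why the final constant does not depend on $d$.

  The cardinality of $F$ is the sum of $n \choose |A|$ times the Lubell weight of $A$. It is split
  into contributions of the superlevel sets $\{k : {n \choose k} \ge t\}$. By unimodality these are
  intervals; their lengths add up to $2^n$, and there are ${n \choose \lfloor n/2 \rfloor}$ of them.
  With $e = 1 - 2/2^d$ and $L^e \le s^e (L/s + 1)$ for every $s > 0$, summation gives
  $|F| \le 3 s^e (2^n / s + {n \choose \lfloor n/2 \rfloor})$
  (\<open>card_le_if_not_contains_cube\<close>). The choice $s = \sqrt n$ balances the two terms, since
  ${n \choose \lfloor n/2 \rfloor} \le 2^n / \sqrt n$, and yields the constant $6$, for all
  $n \ge 1$.
\<close>

section \<open>Boolean algebras and slices\<close>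

text \<open>
  The ground set is left out so that the notion passes to slices, whose members live on a smaller
  ground set; any ground set of \<open>F\<close> automatically contains the sets \<open>X i\<close>.
\<close>

definition contains_cube :: "nat \<Rightarrow> 'a set set \<Rightarrow> bool" where
  "contains_cube d F \<longleftrightarrow>
     (\<exists>X :: nat \<Rightarrow> 'a set. disjoint_family_on X {0..d} \<and> (\<forall>i\<in>{1..d}. X i \<noteq> {}) \<and>
        (\<forall>I\<subseteq>{1..d}. X 0 \<union> \<Union>(X ` I) \<in> F))"

definition slice :: "'a set \<Rightarrow> 'a set set \<Rightarrow> 'a set set" where
  "slice D F = {A \<in> F. A \<inter> D = {} \<and> A \<union> D \<in> F}"

lemma contains_cube_0_iff: "contains_cube 0 F \<longleftrightarrow> F \<noteq> {}"
proof
  assume "F \<noteq> {}"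
  then obtain A where "A \<in> F" by blast
  then show "contains_cube 0 F"
    unfolding contains_cube_def by (intro exI[of _ "\<lambda>_. A"]) (auto simp: disjoint_family_on_def)
qed (auto simp: contains_cube_def)

text \<open>
  The set \<open>D\<close> becomes the last direction: adding it to a member of the slice stays in \<open>F\<close>. It is
  disjoint from the other directions because the top element of the smaller algebra avoids it.
\<close>

lemma contains_cube_Suc_if_slice:
  assumes "D \<noteq> {}" and "contains_cube d (slice D F)"
  shows "contains_cube (Suc d) F"
proof -
  obtain X where disj: "disjoint_family_on X {0..d}" and ne: "\<forall>i\<in>{1..d}. X i \<noteq> {}"
    and mem: "\<And>I. I \<subseteq> {1..d} \<Longrightarrow> X 0 \<union> \<Union>(X ` I) \<in> slice D F"
    using assms(2) unfolding contains_cube_def by blast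
  have "(X 0 \<union> \<Union>(X ` {1..d})) \<inter> D = {}"
    using mem[of "{1..d}"] by (simp add: slice_def)
  moreover have "X i \<subseteq> X 0 \<union> \<Union>(X ` {1..d})" if "i \<le> d" for i
    using that by (cases "i = 0") auto
  ultimately have XD: "X i \<inter> D = {}" if "i \<le> d" for i
    using that by blast
  define Y where "Y = X(Suc d := D)"
  have "disjoint_family_on Y {0..Suc d}"
    unfolding disjoint_family_on_def
  proof (intro ballI impI)
    fix i j assume ij: "i \<in> {0..Suc d}" "j \<in> {0..Suc d}" "i \<noteq> j"
    consider "i = Suc d" | "j = Suc d" | "i \<le> d" "j \<le> d" using ij by force
    then show "Y i \<inter> Y j = {}"
    proof cases
      case 3
      then show ?thesis using disj ij(3) by (auto simp: Y_def disjoint_family_on_def)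
    qed (use ij XD[of i] XD[of j] in \<open>auto simp: Y_def\<close>)
  qed
  moreover have "\<forall>i\<in>{1..Suc d}. Y i \<noteq> {}"
    using ne assms(1) by (auto simp: Y_def)
  moreover have "Y 0 \<union> \<Union>(Y ` I) \<in> F" if I: "I \<subseteq> {1..Suc d}" for I
  proof -
    define J where "J = I - {Suc d}"
    have J: "J \<subseteq> {1..d}" using I unfolding J_def by force
    have YJ: "Y ` J = X ` J" using J by (auto simp: Y_def J_def)
    show ?thesis
    proof (cases "Suc d \<in> I")
      case True
      then have "I = insert (Suc d) J" by (auto simp: J_def)
      then have "Y 0 \<union> \<Union>(Y ` I) = (X 0 \<union> \<Union>(X ` J)) \<union> D"
        using YJ by (auto simp: Y_def)
      then show ?thesis using mem[OF J] by (simp add: slice_def)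
    next
      case False
      then have "I = J" by (auto simp: J_def)
      then have "Y 0 \<union> \<Union>(Y ` I) = X 0 \<union> \<Union>(X ` J)"
        using YJ by (simp add: Y_def)
      then show ?thesis using mem[OF J] by (simp add: slice_def)
    qed
  qed
  ultimately show ?thesis unfolding contains_cube_def by blast
qed

lemma not_contains_cube_if_boolean_algebra_free:
  assumes F: "F \<subseteq> Pow {1..n}" and free: "boolean_algebra_free n d F"
  shows "\<not> contains_cube d F"
proof
  assume "contains_cube d F"
  then obtain X :: "nat \<Rightarrow> nat set" where X: "disjoint_family_on X {0..d}" "\<forall>i\<in>{1..d}. X i \<noteq> {}"
    and mem: "\<And>I. I \<subseteq> {1..d} \<Longrightarrow> X 0 \<union> \<Union>(X ` I) \<in> F"
    unfolding contains_cube_def by blast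
  have "X 0 \<union> \<Union>(X ` {1..d}) \<subseteq> {1..n}" using mem[of "{1..d}"] F by auto
  moreover have "X i \<subseteq> X 0 \<union> \<Union>(X ` {1..d})" if "i \<in> {0..d}" for i
    using that by (cases "i = 0") auto
  ultimately have "\<forall>i\<in>{0..d}. X i \<subseteq> {1..n}" by blast
  with X have "is_boolean_algebra n d {X 0 \<union> (\<Union>i\<in>I. X i) | I. I \<subseteq> {1..d}}"
    unfolding is_boolean_algebra_def by blast
  moreover have "{X 0 \<union> (\<Union>i\<in>I. X i) | I. I \<subseteq> {1..d}} \<subseteq> F" using mem by auto
  ultimately show False using free unfolding boolean_algebra_free_def by blast
qed

section \<open>The second moment along a random maximal chain\<close>

definition lubell :: "'a set \<Rightarrow> 'a set set \<Rightarrow> real" where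
  "lubell V F = (\<Sum>A\<in>F. 1 / real (card V choose card A))"

text \<open>
  A list enumerating the ground set stands for the maximal chain formed by its initial segments.
\<close>

definition in_chain :: "'a list \<Rightarrow> 'a set \<Rightarrow> bool" where
  "in_chain xs A \<longleftrightarrow> set (take (card A) xs) = A"

lemma in_chain_comparable:
  assumes "in_chain xs A" "in_chain xs B"
  shows "A \<subseteq> B \<or> B \<subseteq> A"
  using assms set_take_subset_set_take[of "card A" "card B" xs]
    set_take_subset_set_take[of "card B" "card A" xs] nat_le_linear[of "card A" "card B"]
  unfolding in_chain_def by metis

text \<open>
  Such an enumeration lists \<open>A\<close>, then \<open>D\<close>, then the remaining elements, each part in arbitrary
  order.
\<close>

lemma card_permutations_chain_through_two:
  assumes V: "finite V" and sub: "A \<subseteq> V" "D \<subseteq> V" and disj: "A \<inter> D = {}"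
  shows "card {xs \<in> permutations_of_set V. in_chain xs A \<and> in_chain xs (A \<union> D)} =
    fact (card A) * fact (card D) * fact (card V - card A - card D)"
proof -
  define R where "R = V - A - D"
  have fin: "finite A" "finite D" "finite R"
    using V sub by (auto simp: R_def finite_subset)
  have cU: "card (A \<union> D) = card A + card D" using fin disj by (simp add: card_Un_disjoint)
  have cR: "card R = card V - card A - card D"
  proof -
    have "R = V - (A \<union> D)" by (auto simp: R_def)
    then show ?thesis using cU fin sub by (simp add: card_Diff_subset)
  qed
  let ?P = "permutations_of_set A \<times> permutations_of_set D \<times> permutations_of_set R"
  let ?f = "\<lambda>(us, vs, ws). us @ vs @ ws"
  have len: "length xs = card B" if "xs \<in> permutations_of_set B" for xs :: "'a list" and B
    using that by (rule length_finite_permutations_of_set)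
  have "{xs \<in> permutations_of_set V. in_chain xs A \<and> in_chain xs (A \<union> D)} = ?f ` ?P" (is "?L = _")
  proof (intro equalityI subsetI)
    fix xs assume "xs \<in> ?L"
    then have xs: "set xs = V" "distinct xs" and tA: "set (take (card A) xs) = A"
      and tU: "set (take (card A + card D) xs) = A \<union> D"
      by (auto simp: permutations_of_set_def in_chain_def cU)
    define us where "us = take (card A) xs"
    define vs where "vs = take (card D) (drop (card A) xs)"
    define ws where "ws = drop (card D) (drop (card A) xs)"
    have dec: "xs = us @ vs @ ws" unfolding us_def vs_def ws_def by (metis append_take_drop_id)
    have uv: "take (card A + card D) xs = us @ vs" by (simp add: us_def vs_def take_add)
    have "distinct (us @ vs @ ws)" using xs(2) dec by simp
    then have d: "distinct us" "distinct vs" "distinct ws" "set us \<inter> set vs = {}"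
      "(set us \<union> set vs) \<inter> set ws = {}" by auto
    have sA: "set us = A" using tA us_def by simp
    have sD: "set vs = D" using tU sA d(4) disj unfolding uv by auto
    have sR: "set ws = R" using d(5) sA sD xs(1) unfolding R_def dec by auto
    have "(us, vs, ws) \<in> ?P" using d sA sD sR by (auto simp: permutations_of_set_def)
    then show "xs \<in> ?f ` ?P" using dec by force
  next
    fix xs assume "xs \<in> ?f ` ?P"
    then obtain us vs ws where dec: "xs = us @ vs @ ws" and
      p: "us \<in> permutations_of_set A" "vs \<in> permutations_of_set D" "ws \<in> permutations_of_set R"
      by auto
    have "in_chain xs A" "in_chain xs (A \<union> D)"
      using p len[OF p(1)] len[OF p(2)] cU
      by (auto simp: in_chain_def dec permutations_of_set_def)
    moreover have "xs \<in> permutations_of_set V"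
      using p sub disj by (auto simp: dec permutations_of_set_def R_def)
    ultimately show "xs \<in> ?L" by blast
  qed
  moreover have "inj_on ?f ?P"
  proof (rule inj_onI)
    fix p q assume pq: "p \<in> ?P" "q \<in> ?P" and eq: "?f p = ?f q"
    obtain us vs ws us' vs' ws' where split: "p = (us, vs, ws)" "q = (us', vs', ws')"
      by (metis prod_cases3)
    have "length us = length us'" "length vs = length vs'"
      using pq len unfolding split by fastforce+
    then show "p = q" using eq unfolding split by simp
  qed
  ultimately show ?thesis
    using fin by (simp add: card_image card_cartesian_product cR)
qed

lemma card_permutations_chain_through:
  assumes V: "finite V" and "A \<subseteq> V"
  shows "card {xs \<in> permutations_of_set V. in_chain xs A} = fact (card A) * fact (card V - card A)"
  using card_permutations_chain_through_two[OF V, of "{}" A] assms by (simp add: in_chain_def)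

lemma finite_slice: "finite F \<Longrightarrow> finite (slice D F)"
  by (simp add: slice_def)

text \<open>
  Cauchy-Schwarz for the number \<open>X\<close> of members of \<open>F\<close> on a random maximal chain. Chain members are
  pairwise comparable, so \<open>X\<^sup>2\<close> counts the diagonal once and each pair \<open>A \<subset> B\<close> twice; the pairs
  are then grouped by their difference \<open>D = B - A\<close>.
\<close>

lemma lubell_square_le:
  assumes V: "finite V" and F: "F \<subseteq> Pow V"
  shows "(lubell V F)\<^sup>2 \<le> lubell V F +
    2 * (\<Sum>D\<in>Pow V - {{}}. lubell (V - D) (slice D F) / real (card V choose card D))"
proof -
  define P where "P = permutations_of_set V"
  define n where "n = card V"
  have finF: "finite F" using F V by (meson finite_Pow_iff finite_subset)
  have finP: "finite P" by (simp add: P_def)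
  have cP: "real (card P) = fact n" using V by (simp add: P_def n_def)
  define i where "i = (\<lambda>xs A. of_bool (in_chain xs (A :: 'a set)) :: real)"
  define X where "X = (\<lambda>xs. \<Sum>A\<in>F. i xs A)"
  define S where "S = {(A, B) \<in> F \<times> F. A \<subset> B}"
  have finS: "finite S" by (rule finite_subset[of _ "F \<times> F"]) (auto simp: S_def finF)
  have sub: "A \<subseteq> V" "card A \<le> n" if "A \<in> F" for A
    using that F V by (auto simp: n_def card_mono)
  have first: "(\<Sum>xs\<in>P. X xs) = fact n * lubell V F"
  proof -
    have "(\<Sum>xs\<in>P. X xs) = (\<Sum>A\<in>F. \<Sum>xs\<in>P. i xs A)"
      unfolding X_def by (rule sum.swap)
    also have "\<dots> = (\<Sum>A\<in>F. fact n * (1 / real (n choose card A)))"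
    proof (rule sum.cong)
      fix A assume A: "A \<in> F"
      have "(\<Sum>xs\<in>P. i xs A) = real (card {xs \<in> P. in_chain xs A})"
        using finP by (simp add: i_def Int_def)
      also have "\<dots> = fact (card A) * fact (n - card A)"
        using card_permutations_chain_through[OF V sub(1)[OF A]] by (simp add: P_def n_def)
      also have "\<dots> = fact n * (1 / real (n choose card A))"
        using sub(2)[OF A] by (simp add: binomial_fact)
      finally show "(\<Sum>xs\<in>P. i xs A) = fact n * (1 / real (n choose card A))" .
    qed simp
    finally show ?thesis by (simp add: lubell_def n_def sum_distrib_left)
  qed
  \<comment> \<open>all ordered pairs: equal, increasing and decreasing; the incomparable ones contribute nothing\<close>
  have square: "(X xs)\<^sup>2 = X xs + 2 * (\<Sum>(A, B)\<in>S. i xs A * i xs B)" for xs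
  proof -
    let ?g = "\<lambda>(A, B). i xs A * i xs B"
    let ?Diag = "(\<lambda>A. (A, A)) ` F" and ?T = "prod.swap ` S"
    have "(X xs)\<^sup>2 = sum ?g (F \<times> F)"
      by (simp add: X_def power2_eq_square sum_product sum.cartesian_product)
    also have "\<dots> = sum ?g (?Diag \<union> S \<union> ?T)"
    proof (rule sum.mono_neutral_right)
      show "\<forall>p\<in>F \<times> F - (?Diag \<union> S \<union> ?T). ?g p = 0"
      proof
        fix p assume p: "p \<in> F \<times> F - (?Diag \<union> S \<union> ?T)"
        obtain A B where pAB: "p = (A, B)" by (cases p)
        have AB: "A \<in> F" "B \<in> F" and no: "(A, B) \<notin> ?Diag \<union> S \<union> ?T"
          using p unfolding pAB by blast+
        have "A \<noteq> B" using no AB by auto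
        moreover have "\<not> A \<subset> B" using no AB by (auto simp: S_def)
        moreover have "\<not> B \<subset> A"
        proof
          assume "B \<subset> A"
          then have "(B, A) \<in> S" using AB by (simp add: S_def)
          then have "(A, B) \<in> ?T" by force
          then show False using no by simp
        qed
        ultimately have "\<not> (in_chain xs A \<and> in_chain xs B)"
          using in_chain_comparable[of xs A B] by blast
        then show "?g p = 0" by (auto simp: i_def pAB)
      qed
    qed (auto simp: finF S_def)
    also have "\<dots> = sum ?g ?Diag + sum ?g S + sum ?g ?T"
      by (subst sum.union_disjoint, use finF finS in \<open>auto simp: S_def\<close>)+
    also have "sum ?g ?Diag = X xs"
      by (subst sum.reindex) (auto simp: inj_on_def X_def i_def intro!: sum.cong)
    also have "sum ?g ?T = sum ?g S"
      by (subst sum.reindex) (auto simp: inj_on_def intro!: sum.cong)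
    finally show ?thesis by simp
  qed
  have pairs: "(\<Sum>xs\<in>P. \<Sum>(A, B)\<in>S. i xs A * i xs B) =
    fact n * (\<Sum>D\<in>Pow V - {{}}. lubell (V - D) (slice D F) / real (n choose card D))"
  proof -
    let ?h = "\<lambda>(D, A). (A, A \<union> D)"
    let ?Sig = "Sigma (Pow V - {{}}) (\<lambda>D. slice D F)"
    \<comment> \<open>an increasing pair is determined by its difference and its smaller member\<close>
    have bij: "bij_betw ?h ?Sig S"
      by (rule bij_betwI[where g = "\<lambda>(A, B). (B - A, A)"])
        (use sub in \<open>auto simp: S_def slice_def Un_absorb1\<close>)
    have "(\<Sum>xs\<in>P. \<Sum>(A, B)\<in>S. i xs A * i xs B) = (\<Sum>(A, B)\<in>S. \<Sum>xs\<in>P. i xs A * i xs B)"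
      by (subst sum.swap) (simp add: case_prod_unfold)
    also have "\<dots> = (\<Sum>(D, A)\<in>?Sig. \<Sum>xs\<in>P. i xs A * i xs (A \<union> D))"
      by (subst sum.reindex_bij_betw[OF bij, symmetric]) (simp add: case_prod_unfold)
    also have "\<dots> = (\<Sum>D\<in>Pow V - {{}}. \<Sum>A\<in>slice D F. \<Sum>xs\<in>P. i xs A * i xs (A \<union> D))"
      by (rule sum.Sigma[symmetric]) (use V finF in \<open>auto intro: finite_slice\<close>)
    also have "\<dots> = (\<Sum>D\<in>Pow V - {{}}. fact n * (lubell (V - D) (slice D F) / real (n choose card D)))"
    proof (rule sum.cong)
      fix D assume D: "D \<in> Pow V - {{}}"
      then have cD: "card (V - D) = n - card D" "card D \<le> n"
        using V by (auto simp: n_def card_Diff_subset finite_subset card_mono)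
      have "(\<Sum>xs\<in>P. i xs A * i xs (A \<union> D)) =
          fact n / real (n choose card D) * (1 / real (card (V - D) choose card A))"
        if A: "A \<in> slice D F" for A
      proof -
        have A': "A \<subseteq> V" "A \<inter> D = {}" using A sub by (auto simp: slice_def)
        have "A \<subseteq> V - D" using A' by blast
        then have cA: "card A \<le> n - card D" using V cD(1) by (metis card_mono finite_Diff)
        have "(\<Sum>xs\<in>P. i xs A * i xs (A \<union> D)) =
            real (card {xs \<in> P. in_chain xs A \<and> in_chain xs (A \<union> D)})"
          using finP by (simp add: i_def Int_def flip: of_bool_conj)
        also have "\<dots> = fact (card A) * fact (card D) * fact (n - card A - card D)"
          using card_permutations_chain_through_two[OF V A'(1) _ A'(2)] D by (simp add: P_def n_def)
        also have "\<dots> = fact n / real (n choose card D) * (1 / real (card (V - D) choose card A))"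
          using cA cD by (simp add: binomial_fact add.commute)
        finally show ?thesis .
      qed
      then have "(\<Sum>A\<in>slice D F. \<Sum>xs\<in>P. i xs A * i xs (A \<union> D)) =
          (\<Sum>A\<in>slice D F. fact n / real (n choose card D) * (1 / real (card (V - D) choose card A)))"
        by simp
      also have "\<dots> = fact n / real (n choose card D) * lubell (V - D) (slice D F)"
        by (simp add: lubell_def sum_distrib_left)
      finally show "(\<Sum>A\<in>slice D F. \<Sum>xs\<in>P. i xs A * i xs (A \<union> D)) =
          fact n * (lubell (V - D) (slice D F) / real (n choose card D))" by simp
    qed simp
    finally show ?thesis by (simp add: sum_distrib_left)
  qed
  let ?R = "\<Sum>D\<in>Pow V - {{}}. lubell (V - D) (slice D F) / real (n choose card D)"
  have "(fact n * lubell V F)\<^sup>2 \<le> (\<Sum>xs\<in>P. (X xs)\<^sup>2) * fact n"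
    using sum_squared_le_sum_of_squares[of X P] first cP by simp
  also have "(\<Sum>xs\<in>P. (X xs)\<^sup>2) = (\<Sum>xs\<in>P. X xs) + 2 * (\<Sum>xs\<in>P. \<Sum>(A, B)\<in>S. i xs A * i xs B)"
    by (simp add: square sum.distrib sum_distrib_left)
  also have "\<dots> = fact n * (lubell V F + 2 * ?R)"
    unfolding first pairs by (simp add: algebra_simps)
  finally have "(fact n)\<^sup>2 * (lubell V F)\<^sup>2 \<le> (fact n)\<^sup>2 * (lubell V F + 2 * ?R)"
    by (simp add: power2_eq_square algebra_simps)
  then show ?thesis by (simp add: n_def)
qed

section \<open>The Lubell value of a cube-free family on few levels\<close>

text \<open>
  Each of the \<open>L\<close> possible sizes contributes at most \<open>1\<close>.
\<close>

lemma sum_inverse_binomial_le: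
  assumes V: "finite V"
  shows "(\<Sum>D | D \<subseteq> V \<and> card D < L. 1 / real (card V choose card D)) \<le> real L"
proof -
  have eq: "{D. D \<subseteq> V \<and> card D < L} = (\<Union>k<L. {D. D \<subseteq> V \<and> card D = k})" by auto
  have "(\<Sum>D | D \<subseteq> V \<and> card D < L. 1 / real (card V choose card D)) =
      (\<Sum>k<L. \<Sum>D | D \<subseteq> V \<and> card D = k. 1 / real (card V choose card D))"
    unfolding eq by (rule sum.UNION_disjoint) (use V in auto)
  also have "\<dots> \<le> (\<Sum>k<L. 1)"
  proof (rule sum_mono)
    fix k
    have "(\<Sum>D | D \<subseteq> V \<and> card D = k. 1 / real (card V choose card D)) =
        real (card V choose k) / real (card V choose k)"
      using n_subsets[OF V, of k] by simp
    then show "(\<Sum>D | D \<subseteq> V \<and> card D = k. 1 / real (card V choose card D)) \<le> 1"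
      by simp
  qed
  finally show ?thesis by simp
qed

text \<open>
  The induction starts at dimension \<open>0\<close>, where the family is empty, so the negative exponent \<open>-1\<close> is
  harmless. The constant \<open>3\<close> reproduces itself: with \<open>M\<close> the new power of \<open>L\<close>, the recursion reads
  \<open>h\<^sup>2 \<le> h + 6 * M\<^sup>2\<close>, while \<open>h > 3 * M\<close> and \<open>M \<ge> 1\<close> would give
  \<open>h * (h - 1) > (3 * M) * (2 * M)\<close>.
\<close>

lemma lubell_le_if_not_contains_cube:
  assumes "finite V" "F \<subseteq> Pow V" "\<forall>A\<in>F. a \<le> card A \<and> card A < a + L" "L > 0"
    "\<not> contains_cube d F"
  shows "lubell V F \<le> 3 * real L powr (1 - 2 / 2 ^ d)"
  using assms
proof (induction d arbitrary: V F)
  case 0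
  then have "F = {}" by (simp add: contains_cube_0_iff)
  then show ?case by (simp add: lubell_def)
next
  case (Suc d)
  define M where "M = real L powr (1 - 2 / 2 ^ Suc d)"
  define c where "c = 3 * real L powr (1 - 2 / 2 ^ d)"
  define h where "h = lubell V F"
  have fin: "finite F" using Suc.prems(1,2) by (meson finite_Pow_iff finite_subset)
  have c0: "c \<ge> 0" by (simp add: c_def)
  have M1: "M \<ge> 1" unfolding M_def
    using Suc.prems(4) by (intro ge_one_powr_ge_zero) (auto simp: divide_le_eq)
  \<comment> \<open>adding one to the old exponent gives twice the new one\<close>
  have cM: "real L * c = 3 * M\<^sup>2"
  proof -
    have "real L * real L powr (1 - 2 / 2 ^ d) = real L powr (1 + (1 - 2 / 2 ^ d))"
      using Suc.prems(4) by (subst powr_add) simp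
    also have "\<dots> = real L powr ((1 - 2 / 2 ^ Suc d) + (1 - 2 / 2 ^ Suc d))"
      by (rule arg_cong[of _ _ "\<lambda>e. real L powr e"]) (simp add: field_simps)
    also have "\<dots> = M\<^sup>2" by (subst powr_add) (simp add: M_def power2_eq_square)
    finally show ?thesis by (simp add: c_def)
  qed
  let ?D = "{D. D \<subseteq> V \<and> card D < L}"
  have "(\<Sum>D\<in>Pow V - {{}}. lubell (V - D) (slice D F) / real (card V choose card D)) \<le>
      (\<Sum>D\<in>Pow V - {{}}. if card D < L then c / real (card V choose card D) else 0)"
  proof (rule sum_mono)
    fix D assume D: "D \<in> Pow V - {{}}"
    have finD: "finite D" using D Suc.prems(1) by (auto intro: finite_subset)
    show "lubell (V - D) (slice D F) / real (card V choose card D) \<le>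
        (if card D < L then c / real (card V choose card D) else 0)"
    proof (cases "card D < L")
      case True
      have "lubell (V - D) (slice D F) \<le> c" unfolding c_def
      proof (rule Suc.IH)
        show "slice D F \<subseteq> Pow (V - D)" using Suc.prems(2) by (auto simp: slice_def)
        show "\<not> contains_cube d (slice D F)"
          using contains_cube_Suc_if_slice[of D d F] D Suc.prems(5) by auto
      qed (use Suc.prems in \<open>auto simp: slice_def\<close>)
      then show ?thesis using True by (simp add: divide_right_mono)
    next
      case False
      \<comment> \<open>the sizes of \<open>A\<close> and \<open>A \<union> D\<close> would differ by \<open>L\<close> or more\<close>
      have "slice D F = {}"
      proof (rule ccontr)
        assume "slice D F \<noteq> {}"
        then obtain A where A: "A \<in> F" "A \<inter> D = {}" "A \<union> D \<in> F" by (auto simp: slice_def)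
        have "finite A" using A(1) Suc.prems(1,2) by (auto intro: finite_subset)
        then have "card (A \<union> D) = card A + card D" using A finD by (simp add: card_Un_disjoint)
        moreover have "a \<le> card A" "card (A \<union> D) < a + L" using Suc.prems(3) A by blast+
        ultimately show False using False by linarith
      qed
      then show ?thesis using False by (simp add: lubell_def)
    qed
  qed
  also have "\<dots> = (\<Sum>D\<in>{D \<in> Pow V - {{}}. card D < L}. c / real (card V choose card D))"
    by (rule sum.inter_filter[symmetric]) (use Suc.prems(1) in simp)
  also have "\<dots> \<le> (\<Sum>D\<in>?D. c / real (card V choose card D))"
    by (rule sum_mono2) (use Suc.prems(1) c0 in auto)
  also have "\<dots> = c * (\<Sum>D\<in>?D. 1 / real (card V choose card D))"
    by (simp add: sum_distrib_left)
  also have "\<dots> \<le> c * real L"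
    by (rule mult_left_mono[OF sum_inverse_binomial_le[OF Suc.prems(1)] c0])
  also have "\<dots> = 3 * M\<^sup>2" using cM by (simp add: mult.commute)
  finally have "h\<^sup>2 \<le> h + 6 * M\<^sup>2"
    using lubell_square_le[OF Suc.prems(1,2)] unfolding h_def by linarith
  moreover have "h\<^sup>2 > h + 6 * M\<^sup>2" if "h > 3 * M"
  proof -
    have "(3 * M) * (2 * M) \<le> (3 * M) * (h - 1)" using that M1 by (intro mult_left_mono) auto
    also have "\<dots> < h * (h - 1)" using that M1 by (intro mult_strict_right_mono) auto
    finally show ?thesis by (simp add: power2_eq_square algebra_simps)
  qed
  ultimately show ?case unfolding h_def M_def by fastforce
qed

section \<open>From Lubell values to cardinalities\<close>

lemma binomial_unimodal:
  assumes "i \<le> j" "j \<le> k" "k \<le> n"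
  shows "min (n choose i) (n choose k) \<le> n choose j"
proof (cases "2 * j \<le> n")
  case True
  then show ?thesis using binomial_mono[OF assms(1) True] by (simp add: min.coboundedI1)
next
  case False
  then show ?thesis using binomial_antimono[of j k n] assms by (simp add: min.coboundedI2)
qed

text \<open>
  This replaces the concave power by an affine function of \<open>x\<close>, so that only the number and the
  total length of the superlevel intervals matter below.
\<close>

lemma powr_le_linear:
  fixes e s x :: real
  assumes "0 \<le> e" "e \<le> 1" "s > 0" "x > 0"
  shows "x powr e \<le> s powr e * (x / s + 1)"
proof (cases "x \<le> s")
  case True
  then have "x powr e \<le> s powr e * 1" using assms by (simp add: powr_mono2)
  also have "\<dots> \<le> s powr e * (x / s + 1)" using assms by (intro mult_left_mono) auto
  finally show ?thesis .
next
  case False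
  have "(x / s) powr e \<le> (x / s) powr 1" using False assms by (intro powr_mono) auto
  then have "x powr e / s powr e \<le> x / s" using assms by (simp add: powr_divide)
  then have "x powr e \<le> s powr e * (x / s)" using assms by (simp add: field_simps)
  also have "\<dots> \<le> s powr e * (x / s + 1)" by (intro mult_left_mono) auto
  finally show ?thesis .
qed

text \<open>
  A set \<open>A\<close> belongs to the superlevel families for exactly \<open>n choose card A\<close> thresholds \<open>t\<close>, and in
  each of them it has the reciprocal weight.
\<close>

lemma card_eq_sum_lubell_superlevel:
  assumes V: "finite V" and F: "F \<subseteq> Pow V"
  defines "n \<equiv> card V"
  shows "real (card F) = (\<Sum>t = 1..n choose (n div 2). lubell V {A \<in> F. t \<le> n choose card A})"
proof -
  let ?M = "n choose (n div 2)"
  have fin: "finite F" using F V by (meson finite_Pow_iff finite_subset)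
  have "(\<Sum>t = 1..?M. lubell V {A \<in> F. t \<le> n choose card A}) =
      (\<Sum>t = 1..?M. \<Sum>A\<in>F. if t \<le> n choose card A then 1 / real (n choose card A) else 0)"
    using fin unfolding lubell_def n_def by (intro sum.cong refl sum.inter_filter)
  also have "\<dots> = (\<Sum>A\<in>F. \<Sum>t = 1..?M. if t \<le> n choose card A then 1 / real (n choose card A) else 0)"
    by (rule sum.swap)
  also have "\<dots> = (\<Sum>A\<in>F. 1)"
  proof (rule sum.cong)
    fix A assume "A \<in> F"
    then have "card A \<le> n" using F V by (auto simp: n_def card_mono)
    then have pos: "n choose card A > 0" by simp
    have "{t \<in> {1..?M}. t \<le> n choose card A} = {1..n choose card A}"
      using binomial_maximum[of n "card A"] by auto
    then show "(\<Sum>t = 1..?M. if t \<le> n choose card A then 1 / real (n choose card A) else 0) = 1"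
      using pos by (simp flip: sum.inter_filter)
  qed simp
  finally show ?thesis by simp
qed

lemma sum_card_superlevel_binomial:
  "(\<Sum>t = 1..n choose (n div 2). card {k \<in> {..n}. t \<le> n choose k}) = 2 ^ n"
proof -
  let ?M = "n choose (n div 2)"
  have "(\<Sum>t = 1..?M. card {k \<in> {..n}. t \<le> n choose k}) =
      (\<Sum>t = 1..?M. \<Sum>k\<le>n. if t \<le> n choose k then 1 else 0)"
    by (simp add: sum.inter_filter[symmetric])
  also have "\<dots> = (\<Sum>k\<le>n. \<Sum>t = 1..?M. if t \<le> n choose k then 1 else 0)"
    by (rule sum.swap)
  also have "\<dots> = (\<Sum>k\<le>n. n choose k)"
  proof (rule sum.cong)
    fix k
    have "{t \<in> {1..?M}. t \<le> n choose k} = {1..n choose k}"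
      using binomial_maximum[of n k] by auto
    then show "(\<Sum>t = 1..?M. if t \<le> n choose k then 1 else 0) = n choose k"
      by (simp flip: sum.inter_filter)
  qed simp
  finally show ?thesis by (simp add: choose_row_sum)
qed

text \<open>
  By unimodality each superlevel family occupies an interval of levels, so the Lubell bound applies
  to it with the length of that interval. The scale \<open>s\<close> is left free here; \<open>sqrt n\<close> is the choice
  that balances the two terms on the right.
\<close>

lemma card_le_if_not_contains_cube:
  fixes s :: real
  assumes V: "finite V" and F: "F \<subseteq> Pow V" and free: "\<not> contains_cube d F"
    and d: "d \<ge> 1" and s: "s > 0"
  defines "n \<equiv> card V"
  shows "real (card F) \<le> 3 * s powr (1 - 2 / 2 ^ d) * (2 ^ n / s + real (n choose (n div 2)))"
proof -
  define e :: real where "e = 1 - 2 / 2 ^ d"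
  have "(2::real) ^ 1 \<le> 2 ^ d" using d by (intro power_increasing) auto
  then have e: "0 \<le> e" "e \<le> 1" by (auto simp: e_def divide_le_eq)
  let ?M = "n choose (n div 2)"
  let ?K = "\<lambda>t. {k \<in> {..n}. t \<le> n choose k}"
  have level: "lubell V {A \<in> F. t \<le> n choose card A} \<le> 3 * (s powr e * (real (card (?K t)) / s + 1))"
    if t: "t \<in> {1..?M}" for t
  proof -
    let ?G = "{A \<in> F. t \<le> n choose card A}"
    have fK: "finite (?K t)" by simp
    have "n div 2 \<in> ?K t" using t by simp
    then have neK: "?K t \<noteq> {}" by blast
    define a b where "a = Min (?K t)" and "b = Max (?K t)"
    have ab: "a \<in> ?K t" "b \<in> ?K t" "a \<le> b"
      using Min_in[OF fK neK] Max_in[OF fK neK] Min_le[OF fK] by (auto simp: a_def b_def)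
    define L where "L = b + 1 - a"
    have "{a..b} \<subseteq> ?K t"
    proof
      fix k assume "k \<in> {a..b}"
      then show "k \<in> ?K t" using binomial_unimodal[of a k b n] ab by auto
    qed
    then have L: "L \<le> card (?K t)" "L > 0"
      using card_mono[OF fK, of "{a..b}"] ab(3) by (auto simp: L_def)
    have "lubell V ?G \<le> 3 * real L powr e" unfolding e_def
    proof (rule lubell_le_if_not_contains_cube[OF V])
      show "\<forall>A\<in>?G. a \<le> card A \<and> card A < a + L"
      proof
        fix A assume "A \<in> ?G"
        then have "card A \<in> ?K t" using F V by (auto simp: n_def card_mono)
        then have "a \<le> card A" "card A \<le> b"
          using Min_le[OF fK] Max_ge[OF fK] by (auto simp: a_def b_def)
        then show "a \<le> card A \<and> card A < a + L" by (auto simp: L_def)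
      qed
      show "\<not> contains_cube d ?G"
        using free unfolding contains_cube_def by blast
    qed (use F L in auto)
    also have "\<dots> \<le> 3 * real (card (?K t)) powr e" using L e by (simp add: powr_mono2)
    also have "\<dots> \<le> 3 * (s powr e * (real (card (?K t)) / s + 1))"
      using powr_le_linear[OF e s, of "real (card (?K t))"] L by simp
    finally show ?thesis .
  qed
  have "real (card F) \<le> (\<Sum>t = 1..?M. 3 * (s powr e * (real (card (?K t)) / s + 1)))"
    unfolding card_eq_sum_lubell_superlevel[OF V F] n_def[symmetric] by (intro sum_mono level)
  also have "\<dots> = 3 * s powr e * (real (\<Sum>t = 1..?M. card (?K t)) / s + real ?M)"
    by (simp add: sum_distrib_left[symmetric] sum.distrib sum_divide_distrib[symmetric])
  also have "\<dots> = 3 * s powr e * (2 ^ n / s + real ?M)"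
    by (subst sum_card_superlevel_binomial) simp
  finally show ?thesis by (simp add: e_def)
qed

text \<open>
  The factor \<open>2 * k + 1\<close>, rather than \<open>2 * k\<close>, makes the bound inductive: the step amounts to
  \<open>(2 * k + 1) * (2 * k + 3) \<le> 4 * (k + 1)\<^sup>2\<close>.
\<close>

lemma central_binomial_even_square_le: "(2 * k + 1) * ((2 * k) choose k)\<^sup>2 \<le> 16 ^ k"
proof (induction k)
  case (Suc k)
  define c c' where "c = (2 * k) choose k" and "c' = (2 * k + 2) choose (k + 1)"
  have "c' = 2 * ((2 * k + 1) choose k)"
    using central_binomial_odd[of "2 * k + 1"] by (simp add: c'_def)
  moreover have "(k + 1) * ((2 * k + 1) choose k) = (2 * k + 1) * c"
    using Suc_times_binomial[of k "2 * k"] central_binomial_odd[of "2 * k + 1"] by (simp add: c_def)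
  ultimately have step: "(k + 1) * c' = 2 * (2 * k + 1) * c"
    by (metis mult.assoc mult.left_commute)
  have "(k + 1)\<^sup>2 * ((2 * k + 3) * c'\<^sup>2) = (2 * k + 3) * ((k + 1) * c')\<^sup>2"
    by (simp only: power_mult_distrib mult_ac)
  also have "\<dots> = (4 * (2 * k + 1) * (2 * k + 3)) * ((2 * k + 1) * c\<^sup>2)"
    unfolding step by (simp only: power_mult_distrib) (simp add: power2_eq_square algebra_simps)
  also have "\<dots> \<le> (16 * (k + 1)\<^sup>2) * 16 ^ k"
    by (rule mult_mono[OF _ Suc.IH[folded c_def]]) (auto simp: power2_eq_square algebra_simps)
  also have "\<dots> = (k + 1)\<^sup>2 * 16 ^ Suc k" by simp
  finally have "(2 * k + 3) * c'\<^sup>2 \<le> 16 ^ Suc k"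
    by (subst (asm) mult_le_cancel1) auto
  moreover have "2 * Suc k + 1 = 2 * k + 3" "(2 * Suc k) choose Suc k = c'"
    by (simp_all add: c'_def)
  ultimately show ?case by metis
qed simp

lemma central_binomial_square_le: "n * (n choose (n div 2))\<^sup>2 \<le> 4 ^ n"
proof (cases "even n")
  case True
  then obtain k where k: "n = 2 * k" by blast
  have "n * (n choose (n div 2))\<^sup>2 \<le> (2 * k + 1) * ((2 * k) choose k)\<^sup>2" by (simp add: k)
  also have "\<dots> \<le> 16 ^ k" by (rule central_binomial_even_square_le)
  finally show ?thesis by (simp add: k power_mult)
next
  case False
  then obtain k where k: "n = 2 * k + 1" by (auto elim: oddE)
  \<comment> \<open>an odd central coefficient is half of the next, even one\<close>
  have "2 * (n choose (n div 2)) = (2 * k + 2) choose (k + 1)"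
    using central_binomial_odd[of "2 * k + 1"] by (simp add: k)
  then have "n * ((2 * (k + 1)) choose (k + 1))\<^sup>2 = n * (2 * (n choose (n div 2)))\<^sup>2"
    by simp
  then have "4 * (n * (n choose (n div 2))\<^sup>2) = n * ((2 * (k + 1)) choose (k + 1))\<^sup>2"
    by (simp only: power_mult_distrib) simp
  also have "\<dots> \<le> (2 * (k + 1) + 1) * ((2 * (k + 1)) choose (k + 1))\<^sup>2"
    by (intro mult_right_mono) (auto simp: k)
  also have "\<dots> \<le> 16 ^ (k + 1)" by (rule central_binomial_even_square_le)
  also have "\<dots> = 4 * 4 ^ n" by (simp add: k power_mult)
  finally show ?thesis by simp
qed

lemma central_binomial_le:
  assumes "n > 0"
  shows "real (n choose (n div 2)) \<le> 2 ^ n / sqrt (real n)"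
proof -
  have "real (n * (n choose (n div 2))\<^sup>2) \<le> real (4 ^ n)"
    using central_binomial_square_le[of n] by (rule of_nat_mono)
  moreover have "(sqrt (real n) * real (n choose (n div 2)))\<^sup>2 = real (n * (n choose (n div 2))\<^sup>2)"
    by (simp add: power_mult_distrib)
  moreover have "real (4 ^ n) = (2 ^ n)\<^sup>2"
    by (simp add: power2_eq_square flip: power_mult_distrib)
  ultimately have "(sqrt (real n) * real (n choose (n div 2)))\<^sup>2 \<le> (2 ^ n)\<^sup>2" by simp
  then have "sqrt (real n) * real (n choose (n div 2)) \<le> 2 ^ n"
    by (rule power2_le_imp_le) simp
  then show ?thesis using assms by (simp add: field_simps)
qed

theorem theorem1:
  shows "\<exists>C::real. C > 0 \<and>
    (\<forall>d::nat. d \<ge> 1 \<longrightarrow>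
      (\<exists>N::nat. \<forall>n::nat. n \<ge> N \<longrightarrow>
        real (boolean_free_number n d) \<le> C * real n powr (- (1 / 2 ^ d)) * 2 ^ n))"
proof (rule exI[of _ 6], intro conjI allI impI)
  fix d :: nat assume d: "d \<ge> 1"
  show "\<exists>N::nat. \<forall>n::nat. n \<ge> N \<longrightarrow>
        real (boolean_free_number n d) \<le> 6 * real n powr (- (1 / 2 ^ d)) * 2 ^ n"
  proof (rule exI[of _ 1], intro allI impI)
    fix n :: nat assume n: "n \<ge> 1"
    let ?S = "{card F | F. F \<subseteq> Pow {1..n} \<and> boolean_algebra_free n d F}"
    have "finite ?S" by (rule finite_subset[of _ "card ` Pow (Pow {1..n})"]) auto
    moreover have "?S \<noteq> {}"
    proof -
      have "boolean_algebra_free n d {}"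
        by (auto simp: boolean_algebra_free_def is_boolean_algebra_def)
      then show ?thesis by blast
    qed
    ultimately have "boolean_free_number n d \<in> ?S"
      unfolding boolean_free_number_def by (rule Max_in)
    then obtain F where F: "F \<subseteq> Pow {1..n}" "boolean_algebra_free n d F"
      and card: "boolean_free_number n d = card F" by blast
    define s where "s = sqrt (real n)"
    have s: "s > 0" using n by (simp add: s_def)
    have "real (card F) \<le> 3 * s powr (1 - 2 / 2 ^ d) * (2 ^ n / s + real (n choose (n div 2)))"
      using card_le_if_not_contains_cube[OF _ F(1) not_contains_cube_if_boolean_algebra_free[OF F] d s]
      by simp
    also have "\<dots> \<le> 3 * s powr (1 - 2 / 2 ^ d) * (2 ^ n / s + 2 ^ n / s)"
      using central_binomial_le[of n] n by (intro mult_left_mono) (auto simp: s_def)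
    also have "\<dots> = 6 * (s powr (1 - 2 / 2 ^ d) / s powr 1) * 2 ^ n"
      using s by simp
    also have "s powr (1 - 2 / 2 ^ d) / s powr 1 = s powr (- 2 / 2 ^ d)"
      by (subst powr_diff[symmetric]) simp
    also have "\<dots> = real n powr (- (1 / 2 ^ d))"
      using n by (simp add: s_def powr_half_sqrt[symmetric] powr_powr)
    finally show "real (boolean_free_number n d) \<le> 6 * real n powr (- (1 / 2 ^ d)) * 2 ^ n"
      using card by simp
  qed
qed simp

end
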